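(* Let $1<p<\infty$, let $v$ be a weight function on $\mathbb{R}$, and let $\phi\in L^1(\mathbb{R})$. If the operator $H_{\alpha,\phi}$ is a bounded operator on $L^p_v(\mathbb{R})$, then its operator norm satisfies $$\|H_{\alpha,\phi}\|\ \ge\ \int_{\mathbb{R}} \frac{|\phi(t)|}{|t|^{2\alpha+2-\frac1p}}\left(\inf_{y\in\mathbb{R}}\frac{v(ty)}{v(y)}\right)^{1/p}dt=:A_{\inf} .$$
   Context: A weight function is a function which is measurable, positive and finite almost everywhere on its domain. $L^p_v(\mathbb{R})$ is the weighted Lebesgue space with norm $\|f\|_{L^p_v(\mathbb{R})}=\left(\int_{\mathbb{R}}|f(x)|^p v(x)\,dx\right)^{1/p}$. For a real parameter $\alpha$ and $\phi\in L^1(\mathbb{R})$, the Dunkl-Hausdorff operator is $$H_{\alpha,\phi}f(x)=\int_{\mathbb{R}}\frac{|\phi(t)|}{|t|^{2\alpha+2}}f\left(\frac{x}{t}\right)dt ,$$ and $\|H_{\alpha,\phi}\|$ denotes its operator norm from $L^p_v(\mathbb{R})$ to $L^p_v(\mathbb{R})$. *)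

theory Defs
  imports "HOL-Analysis.Analysis"
begin

text \<open>Measurability and "almost everywhere" refer to Lebesgue measure on the line. Functions are
  complex-valued. Elements of the weighted spaces are functions rather than equivalence classes.\<close>

definition weight :: "(real \<Rightarrow> ennreal) \<Rightarrow> bool" where
  "weight v \<longleftrightarrow> v \<in> borel_measurable lebesgue \<and> (AE x in lebesgue. 0 < v x \<and> v x < \<infinity>)"

definition Lpv_integral :: "real \<Rightarrow> (real \<Rightarrow> ennreal) \<Rightarrow> (real \<Rightarrow> complex) \<Rightarrow> ennreal" where
  "Lpv_integral p v f = (\<integral>\<^sup>+ x. ennreal (cmod (f x) powr p) * v x \<partial>lebesgue)"

definition Lpv :: "real \<Rightarrow> (real \<Rightarrow> ennreal) \<Rightarrow> (real \<Rightarrow> complex) set" where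
  "Lpv p v = {f. f \<in> borel_measurable lebesgue \<and> Lpv_integral p v f < \<infinity>}"

definition Lpv_norm :: "real \<Rightarrow> (real \<Rightarrow> ennreal) \<Rightarrow> (real \<Rightarrow> complex) \<Rightarrow> real" where
  "Lpv_norm p v f = enn2real (Lpv_integral p v f) powr (1 / p)"

definition dunkl_hausdorff_integrand ::
    "real \<Rightarrow> (real \<Rightarrow> complex) \<Rightarrow> (real \<Rightarrow> complex) \<Rightarrow> real \<Rightarrow> real \<Rightarrow> complex" where
  "dunkl_hausdorff_integrand \<alpha> \<phi> f x t =
     complex_of_real (cmod (\<phi> t) / \<bar>t\<bar> powr (2 * \<alpha> + 2)) * f (x / t)"

definition dunkl_hausdorff ::
    "real \<Rightarrow> (real \<Rightarrow> complex) \<Rightarrow> (real \<Rightarrow> complex) \<Rightarrow> real \<Rightarrow> complex" where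
  "dunkl_hausdorff \<alpha> \<phi> f x = (LINT t|lebesgue. dunkl_hausdorff_integrand \<alpha> \<phi> f x t)"

text \<open>Boundedness includes that the defining integral converges absolutely for almost every
  \<open>x\<close>; this has to be demanded separately, because the Bochner integral of a non-integrable
  function is 0 by convention. Given convergence, linearity (almost everywhere) is automatic.\<close>

definition dunkl_hausdorff_bounded ::
    "real \<Rightarrow> (real \<Rightarrow> complex) \<Rightarrow> real \<Rightarrow> (real \<Rightarrow> ennreal) \<Rightarrow> bool" where
  "dunkl_hausdorff_bounded \<alpha> \<phi> p v \<longleftrightarrow>
     (\<forall>f \<in> Lpv p v.
        (AE x in lebesgue. integrable lebesgue (dunkl_hausdorff_integrand \<alpha> \<phi> f x)) \<and>
        dunkl_hausdorff \<alpha> \<phi> f \<in> Lpv p v) \<and>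
     (\<exists>C. \<forall>f \<in> Lpv p v. Lpv_norm p v (dunkl_hausdorff \<alpha> \<phi> f) \<le> C * Lpv_norm p v f)"

text \<open>The operator norm in the form of \<^const>\<open>onorm\<close>, which itself needs a type of class
  \<^class>\<open>real_normed_vector\<close>. Functions of norm 0 contribute 0, since \<open>c / 0 = 0\<close>. The real
  supremum is meaningful for bounded operators only.\<close>

definition Lpv_onorm ::
    "real \<Rightarrow> (real \<Rightarrow> ennreal) \<Rightarrow> ((real \<Rightarrow> complex) \<Rightarrow> (real \<Rightarrow> complex)) \<Rightarrow> real" where
  "Lpv_onorm p v T = (SUP f \<in> Lpv p v. Lpv_norm p v (T f) / Lpv_norm p v f)"

text \<open>The infimum of \<open>v (t * y) / v y\<close> over all \<open>y\<close> for which this is a quotient of positive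
  finite numbers. A weight may be 0 or infinite on a null set (typically at 0, as for power
  weights), where the conventions \<open>0 / 0 = 0\<close> and \<open>\<infinity> / \<infinity> = 0\<close> would spuriously force the infimum
  to be 0. For a weight and \<open>t \<noteq> 0\<close> almost every \<open>y\<close> is admitted, so the infimum is over a nonempty
  set; the value at \<open>t = 0\<close> is irrelevant below.\<close>

definition inf_ratio :: "(real \<Rightarrow> ennreal) \<Rightarrow> real \<Rightarrow> real" where
  "inf_ratio v t =
     (INF y \<in> {y. 0 < v y \<and> v y < \<infinity> \<and> 0 < v (t * y) \<and> v (t * y) < \<infinity>}.
        enn2real (v (t * y)) / enn2real (v y))"

text \<open>A pointwise infimum over uncountably many \<open>y\<close> need not be measurable in \<open>t\<close>; in that case
  the integral below is the lower integral.\<close>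

definition A_inf :: "real \<Rightarrow> (real \<Rightarrow> complex) \<Rightarrow> real \<Rightarrow> (real \<Rightarrow> ennreal) \<Rightarrow> ennreal" where
  "A_inf \<alpha> \<phi> p v =
     (\<integral>\<^sup>+ t. ennreal (cmod (\<phi> t) / \<bar>t\<bar> powr (2 * \<alpha> + 2 - 1 / p) * inf_ratio v t powr (1 / p))
        \<partial>lebesgue)"

end

theory Submission
  imports Defs
begin

text \<open>The operator \<open>H\<close> is tested on the functions \<open>f x = (v x * \<bar>x\<bar>) powr (- 1 / p)\<close>, cut off to an
  annulus \<open>1 \<le> \<bar>x\<bar> \<le> b\<close>. Without the cut-off, \<open>f\<close> would be an eigenfunction with eigenvalue
  \<open>A_inf\<close> if the ratio \<open>v (t * y) / v y\<close> did not depend on \<open>y\<close>; in general, bounding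
  \<open>v x / v (x / t)\<close> from below by its infimum gives \<open>H f x \<ge> A_inf * f x\<close> (lemma
  \<open>extremal_scaling\<close> is this inequality under the integral sign). Only the norm of \<open>f\<close> would be
  infinite, because \<open>1 / \<bar>x\<bar>\<close> is not integrable.

  The truncation costs little. If only \<open>t\<close> with \<open>1 / R \<le> \<bar>t\<bar> \<le> R\<close> are kept in the integral, then
  \<open>x / t\<close> stays in the annulus as long as \<open>R \<le> \<bar>x\<bar> \<le> b / R\<close>. The \<open>p\<close>-th power of the norm of \<open>f\<close> is
  \<open>2 * ln b\<close>, and that of \<open>f\<close> on the smaller annulus is \<open>2 * (ln b - 2 * ln R)\<close>
  (lemma \<open>nn_integral_inverse_annulus\<close>); their quotient tends to 1 as \<open>b\<close> tends to infinity.
  Hence the norm is at least the part of \<open>A_inf\<close> that comes from \<open>1 / R \<le> \<bar>t\<bar> \<le> R\<close>, and \<open>R\<close> is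
  sent to infinity by monotone convergence.

  The integrand of \<open>A_inf\<close> may fail to be measurable. The argument is therefore carried out for
  a measurable minorant \<open>g\<close> of it, and the supremum over simple \<open>g\<close> is taken at the end.\<close>

definition annulus :: "real \<Rightarrow> real \<Rightarrow> real set" where
  "annulus a b = {x. a \<le> \<bar>x\<bar> \<and> \<bar>x\<bar> \<le> b}"

lemma annulus_measurable [measurable]: "annulus a b \<in> sets borel"
  unfolding annulus_def by measurable

text \<open>Points at which the weight is 0 or infinite are given the value 0; they form a null set.\<close>

definition extremal_real :: "real \<Rightarrow> (real \<Rightarrow> ennreal) \<Rightarrow> real \<Rightarrow> real \<Rightarrow> real" where
  "extremal_real p v b x =
     (if x \<in> annulus 1 b \<and> 0 < v x \<and> v x < \<infinity> then (enn2real (v x) * \<bar>x\<bar>) powr (- 1 / p) else 0)"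

abbreviation extremal :: "real \<Rightarrow> (real \<Rightarrow> ennreal) \<Rightarrow> real \<Rightarrow> real \<Rightarrow> complex" where
  "extremal p v b x \<equiv> complex_of_real (extremal_real p v b x)"

lemma extremal_real_nonneg: "0 \<le> extremal_real p v b x"
  by (simp add: extremal_real_def)


section \<open>The norm of the test functions\<close>

lemma nn_integral_inverse_annulus:
  assumes "0 < a" "a \<le> b"
  shows "(\<integral>\<^sup>+ x. ennreal (1 / \<bar>x\<bar>) * indicator (annulus a b) x \<partial>lebesgue) = ennreal (2 * (ln b - ln a))"
proof -
  have split: "ennreal (1 / \<bar>x\<bar>) * indicator (annulus a b) x =
      ennreal (1 / x) * indicator {a..b} x + ennreal (- 1 / x) * indicator {- b..- a} x" for x :: real
    using assms by (auto simp: annulus_def indicator_def)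
  have pos: "(\<integral>\<^sup>+ x. ennreal (1 / x) * indicator {a..b} x \<partial>lborel) = ennreal (ln b - ln a)"
  proof (rule nn_integral_FTC_Icc)
    fix x assume "x \<in> {a..b}"
    then have "0 < x" using assms by auto
    then show "(ln has_real_derivative 1 / x) (at x)"
      by (auto intro!: derivative_eq_intros)
    show "0 \<le> 1 / x" using \<open>0 < x\<close> by simp
  qed (use assms in auto)
  have neg: "(\<integral>\<^sup>+ x. ennreal (- 1 / x) * indicator {- b..- a} x \<partial>lborel)
      = ennreal ((- ln (- (- a))) - (- ln (- (- b))))"
  proof (rule nn_integral_FTC_Icc)
    fix x assume "x \<in> {- b..- a}"
    then have "x < 0" using assms by auto
    then show "((\<lambda>x. - ln (- x)) has_real_derivative - 1 / x) (at x)"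
      by (auto intro!: derivative_eq_intros simp: divide_simps)
    show "0 \<le> - 1 / x" using \<open>x < 0\<close> by (simp add: divide_nonneg_nonpos)
  qed (use assms in auto)
  have "(\<integral>\<^sup>+ x. ennreal (1 / \<bar>x\<bar>) * indicator (annulus a b) x \<partial>lebesgue)
      = (\<integral>\<^sup>+ x. ennreal (1 / x) * indicator {a..b} x \<partial>lborel)
        + (\<integral>\<^sup>+ x. ennreal (- 1 / x) * indicator {- b..- a} x \<partial>lborel)"
    unfolding split nn_integral_completion by (rule nn_integral_add) measurable
  also have "\<dots> = ennreal (2 * (ln b - ln a))"
    unfolding pos neg using assms by (simp flip: ennreal_plus)
  finally show ?thesis .
qed

lemma extremal_measurable:
  assumes "v \<in> borel_measurable lebesgue"
  shows "extremal p v b \<in> borel_measurable lebesgue"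
proof -
  have [measurable]: "v \<in> borel_measurable lebesgue" "(\<lambda>x::real. x) \<in> borel_measurable lebesgue"
    using assms by (auto intro: measurable_completion)
  have [measurable]: "Measurable.pred lebesgue (\<lambda>x. x \<in> annulus 1 b)"
    unfolding annulus_def by measurable
  show ?thesis
    unfolding extremal_real_def by measurable
qed

text \<open>The weight cancels, so the norms of the test functions do not depend on it.\<close>

lemma ennreal_scaled_powr_mult_weight:
  fixes w :: ennreal
  assumes "0 < p" "0 < w" "w < \<infinity>" "0 < y" "0 \<le> a"
  shows "ennreal ((a * (enn2real w * y) powr (- 1 / p)) powr p) * w = ennreal (a powr p) * ennreal (1 / y)"
proof -
  obtain W where W: "w = ennreal W" "0 < W"
    using assms by (cases w) auto
  have "(a * (W * y) powr (- 1 / p)) powr p = a powr p * (1 / (W * y))"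
    using assms W by (simp add: powr_mult powr_divide powr_powr powr_minus_divide)
  then have "ennreal ((a * (enn2real w * y) powr (- 1 / p)) powr p) * w
      = ennreal (a powr p * (1 / (W * y)) * W)"
    using assms W by (simp add: ennreal_mult[symmetric])
  also have "a powr p * (1 / (W * y)) * W = a powr p * (1 / y)"
    using W assms by (simp add: field_simps)
  also have "ennreal (a powr p * (1 / y)) = ennreal (a powr p) * ennreal (1 / y)"
    using assms by (intro ennreal_mult) auto
  finally show ?thesis .
qed

lemma Lpv_integral_extremal:
  assumes "0 < p" "weight v" "1 \<le> b"
  shows "Lpv_integral p v (extremal p v b) = ennreal (2 * ln b)"
proof -
  have "AE x in lebesgue. 0 < v x \<and> v x < \<infinity>"
    using assms by (simp add: weight_def)
  then have "AE x in lebesgue. ennreal (cmod (extremal p v b x) powr p) * v x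
      = ennreal (1 / \<bar>x\<bar>) * indicator (annulus 1 b) x"
  proof eventually_elim
    case (elim x)
    show ?case
    proof (cases "x \<in> annulus 1 b")
      case True
      then have "0 < \<bar>x\<bar>" by (auto simp: annulus_def)
      then show ?thesis
        using ennreal_scaled_powr_mult_weight[of p "v x" "\<bar>x\<bar>" 1] elim assms True
        by (simp add: extremal_real_def)
    qed (simp add: extremal_real_def)
  qed
  then have "Lpv_integral p v (extremal p v b)
      = (\<integral>\<^sup>+ x. ennreal (1 / \<bar>x\<bar>) * indicator (annulus 1 b) x \<partial>lebesgue)"
    unfolding Lpv_integral_def by (rule nn_integral_cong_AE)
  then show ?thesis
    using nn_integral_inverse_annulus[of 1 b] assms by simp
qed


section \<open>The operator on the test functions\<close>

text \<open>Inversion is smooth off the origin, so it preserves null sets.\<close>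

lemma AE_lebesgue_divide:
  fixes x :: real
  assumes "AE y in lebesgue. P y" "x \<noteq> 0"
  shows "AE t in lebesgue. P (x / t)"
proof -
  obtain N where "N \<in> null_sets lebesgue" "{y. \<not> P y} \<subseteq> N"
    using assms(1) unfolding eventually_ae_filter by auto
  then have null: "negligible {y. \<not> P y}"
    by (meson negligible_iff_null_sets negligible_subset)
  have "negligible ((\<lambda>y. x / y) ` ({y. \<not> P y} - {0}))"
  proof (rule negligible_differentiable_image_negligible)
    show "negligible ({y. \<not> P y} - {0})"
      using null by (rule negligible_subset) auto
    show "(\<lambda>y. x / y) differentiable_on ({y. \<not> P y} - {0})"
      by (auto simp: differentiable_on_def intro!: derivative_intros)
  qed simp
  then have "negligible (insert 0 ((\<lambda>y. x / y) ` ({y. \<not> P y} - {0})))"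
    by simp
  moreover have "{t. \<not> P (x / t)} \<subseteq> insert 0 ((\<lambda>y. x / y) ` ({y. \<not> P y} - {0}))"
  proof
    fix t assume t: "t \<in> {t. \<not> P (x / t)}"
    show "t \<in> insert 0 ((\<lambda>y. x / y) ` ({y. \<not> P y} - {0}))"
    proof (cases "t = 0")
      case False
      then have "x / t \<in> {y. \<not> P y} - {0}" "t = x / (x / t)"
        using t assms(2) by auto
      then show ?thesis by blast
    qed simp
  qed
  ultimately show ?thesis
    by (intro AE_I') (auto simp: negligible_iff_null_sets)
qed

lemma inf_ratio_bounds:
  assumes "0 < v y" "v y < \<infinity>" "0 < v (t * y)" "v (t * y) < \<infinity>"
  shows "0 \<le> inf_ratio v t" "inf_ratio v t \<le> enn2real (v (t * y)) / enn2real (v y)"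
proof -
  let ?S = "{y. 0 < v y \<and> v y < \<infinity> \<and> 0 < v (t * y) \<and> v (t * y) < \<infinity>}"
  have y: "y \<in> ?S" using assms by simp
  show "0 \<le> inf_ratio v t"
    unfolding inf_ratio_def by (rule cINF_greatest) (use y in auto)
  show "inf_ratio v t \<le> enn2real (v (t * y)) / enn2real (v y)"
    unfolding inf_ratio_def
    by (rule cINF_lower[OF _ y]) (auto intro!: bdd_belowI[of _ 0])
qed

text \<open>The factor \<open>\<bar>t\<bar> powr (1 / p)\<close> by which the kernels of \<open>A_inf\<close> and of the operator differ comes
  from \<open>\<bar>x / t\<bar> powr (- 1 / p)\<close>.\<close>

lemma extremal_scaling:
  assumes "0 < p" "0 < v x" "v x < \<infinity>" "0 < v (x / t)" "v (x / t) < \<infinity>"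
    and "t \<noteq> 0" "x \<noteq> 0" "x / t \<in> annulus 1 b" "0 \<le> c"
  shows "c / \<bar>t\<bar> powr (2 * \<alpha> + 2 - 1 / p) * inf_ratio v t powr (1 / p)
           * (enn2real (v x) * \<bar>x\<bar>) powr (- 1 / p)
         \<le> c / \<bar>t\<bar> powr (2 * \<alpha> + 2) * extremal_real p v b (x / t)"
proof -
  define V where "V = enn2real (v x)"
  define W where "W = enn2real (v (x / t))"
  have VW: "0 < V" "0 < W"
    using assms by (auto simp: V_def W_def enn2real_positive_iff)
  have r: "0 \<le> inf_ratio v t" "inf_ratio v t \<le> V / W"
    using inf_ratio_bounds[of v "x / t" t] assms by (simp_all add: V_def W_def)
  have "inf_ratio v t powr (1 / p) \<le> (V / W) powr (1 / p)"
    using r assms by (intro powr_mono2) auto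
  then have "c / \<bar>t\<bar> powr (2 * \<alpha> + 2 - 1 / p) * inf_ratio v t powr (1 / p) * (V * \<bar>x\<bar>) powr (- 1 / p)
      \<le> c / \<bar>t\<bar> powr (2 * \<alpha> + 2 - 1 / p) * (V / W) powr (1 / p) * (V * \<bar>x\<bar>) powr (- 1 / p)"
    using assms by (intro mult_right_mono mult_left_mono) auto
  also have "\<dots> = c / \<bar>t\<bar> powr (2 * \<alpha> + 2) * (W * \<bar>x / t\<bar>) powr (- 1 / p)"
  proof -
    define k where "k = 2 * \<alpha> + 2 - 1 / p"
    have "\<bar>t\<bar> powr (2 * \<alpha> + 2) = \<bar>t\<bar> powr k * \<bar>t\<bar> powr (1 / p)"
      by (simp add: k_def flip: powr_add)
    then show ?thesis
      unfolding k_def[symmetric] using VW assms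
      by (simp add: powr_mult powr_divide powr_minus_divide abs_divide)
  qed
  also have "(W * \<bar>x / t\<bar>) powr (- 1 / p) = extremal_real p v b (x / t)"
    using assms by (simp add: extremal_real_def W_def)
  finally show ?thesis by (simp add: V_def)
qed

lemma divide_in_annulus:
  assumes "0 < R" "t \<in> annulus (1 / R) R" "x \<in> annulus R (b / R)"
  shows "t \<noteq> 0" "x \<noteq> 0" "x / t \<in> annulus 1 b"
proof -
  have t: "1 \<le> \<bar>t\<bar> * R" "\<bar>t\<bar> \<le> R" and x: "R \<le> \<bar>x\<bar>" "\<bar>x\<bar> * R \<le> b"
    using assms by (auto simp: annulus_def field_simps)
  show t0: "t \<noteq> 0" and x0: "x \<noteq> 0"
    using t x assms by auto
  have "\<bar>x\<bar> * 1 \<le> \<bar>x\<bar> * (\<bar>t\<bar> * R)"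
    using t by (intro mult_left_mono) auto
  also have "\<dots> = \<bar>t\<bar> * (\<bar>x\<bar> * R)" by simp
  also have "\<dots> \<le> \<bar>t\<bar> * b"
    using x by (intro mult_left_mono) auto
  finally show "x / t \<in> annulus 1 b"
    using t x t0 by (auto simp: annulus_def abs_divide field_simps)
qed

lemma dunkl_hausdorff_extremal_ge:
  fixes g :: "real \<Rightarrow> ennreal"
  assumes "0 < p" "weight v" "0 < R"
    and g: "g \<in> borel_measurable lebesgue"
      "\<And>t. g t \<le> ennreal (cmod (\<phi> t) / \<bar>t\<bar> powr (2 * \<alpha> + 2 - 1 / p) * inf_ratio v t powr (1 / p))"
    and int: "integrable lebesgue (dunkl_hausdorff_integrand \<alpha> \<phi> (extremal p v b) x)"
    and x: "x \<in> annulus R (b / R)" "0 < v x" "v x < \<infinity>"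
  shows "(\<integral>\<^sup>+ t. g t * indicator (annulus (1 / R) R) t \<partial>lebesgue)
           * ennreal ((enn2real (v x) * \<bar>x\<bar>) powr (- 1 / p))
         \<le> ennreal (cmod (dunkl_hausdorff \<alpha> \<phi> (extremal p v b) x))"
proof -
  define h where "h t = cmod (\<phi> t) / \<bar>t\<bar> powr (2 * \<alpha> + 2) * extremal_real p v b (x / t)" for t
  define e where "e = (enn2real (v x) * \<bar>x\<bar>) powr (- 1 / p)"
  have e0: "0 \<le> e" by (simp add: e_def)
  have h0: "0 \<le> h t" for t
    by (simp add: h_def extremal_real_nonneg)
  have h: "dunkl_hausdorff_integrand \<alpha> \<phi> (extremal p v b) x = (\<lambda>t. complex_of_real (h t))"
    by (auto simp: dunkl_hausdorff_integrand_def h_def)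
  have int_h: "integrable lebesgue h"
    using int unfolding h by (simp add: complex_of_real_integrable_eq)
  have "0 \<le> (LINT t|lebesgue. h t)"
    using h0 by (simp add: integral_nonneg)
  then have norm: "cmod (dunkl_hausdorff \<alpha> \<phi> (extremal p v b) x) = (LINT t|lebesgue. h t)"
    unfolding dunkl_hausdorff_def h by simp
  have x0: "x \<noteq> 0" using x(1) assms(3) by (auto simp: annulus_def)
  have [measurable]: "g \<in> borel_measurable lebesgue"
    "annulus (1 / R) R \<in> sets lebesgue"
    using g(1) by auto
  have "AE y in lebesgue. 0 < v y \<and> v y < \<infinity>"
    using assms(2) by (simp add: weight_def)
  from AE_lebesgue_divide[OF this x0]
  have "AE t in lebesgue. g t * indicator (annulus (1 / R) R) t * ennreal e \<le> ennreal (h t)"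
  proof eventually_elim
    case (elim t)
    show ?case
    proof (cases "t \<in> annulus (1 / R) R")
      case True
      note d = divide_in_annulus[OF assms(3) True x(1)]
      have "g t * ennreal e
          \<le> ennreal (cmod (\<phi> t) / \<bar>t\<bar> powr (2 * \<alpha> + 2 - 1 / p) * inf_ratio v t powr (1 / p)) * ennreal e"
        using g(2) by (intro mult_right_mono) auto
      also have "\<dots> = ennreal (cmod (\<phi> t) / \<bar>t\<bar> powr (2 * \<alpha> + 2 - 1 / p) * inf_ratio v t powr (1 / p) * e)"
        using e0 by (intro ennreal_mult[symmetric]) auto
      also have "\<dots> \<le> ennreal (h t)"
        unfolding e_def h_def
        by (intro ennreal_leI extremal_scaling) (use assms x elim d in auto)
      finally show ?thesis using True by simp
    qed simp
  qed
  then have "(\<integral>\<^sup>+ t. g t * indicator (annulus (1 / R) R) t * ennreal e \<partial>lebesgue)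
      \<le> (\<integral>\<^sup>+ t. ennreal (h t) \<partial>lebesgue)"
    by (rule nn_integral_mono_AE)
  also have "\<dots> = ennreal (LINT t|lebesgue. h t)"
    using int_h h0 by (intro nn_integral_eq_integral) auto
  finally show ?thesis
    unfolding norm e_def[symmetric] by (subst (asm) nn_integral_multc) auto
qed

text \<open>The pointwise bound is raised to the power \<open>p\<close> and integrated. A real lower bound \<open>a\<close> stands
  for the integral over \<open>t\<close>, which is not known to be finite at this stage.\<close>

lemma Lpv_integral_dunkl_hausdorff_extremal_ge:
  fixes g :: "real \<Rightarrow> ennreal"
  assumes "0 < p" "weight v" "0 < R" "R\<^sup>2 \<le> b"
    and g: "g \<in> borel_measurable lebesgue"
      "\<And>t. g t \<le> ennreal (cmod (\<phi> t) / \<bar>t\<bar> powr (2 * \<alpha> + 2 - 1 / p) * inf_ratio v t powr (1 / p))"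
    and int: "AE x in lebesgue. integrable lebesgue (dunkl_hausdorff_integrand \<alpha> \<phi> (extremal p v b) x)"
    and a: "0 \<le> a" "ennreal a \<le> (\<integral>\<^sup>+ t. g t * indicator (annulus (1 / R) R) t \<partial>lebesgue)"
  shows "ennreal (a powr p * (2 * (ln b - 2 * ln R)))
         \<le> Lpv_integral p v (dunkl_hausdorff \<alpha> \<phi> (extremal p v b))"
proof -
  let ?H = "dunkl_hausdorff \<alpha> \<phi> (extremal p v b)"
  have b: "0 < b" "R \<le> b / R"
    using assms(3,4) by (auto simp: power2_eq_square field_simps intro: less_le_trans[OF mult_pos_pos])
  have "AE x in lebesgue. 0 < v x \<and> v x < \<infinity>"
    using assms(2) by (simp add: weight_def)
  then have "AE x in lebesgue. ennreal (a powr p) * (ennreal (1 / \<bar>x\<bar>) * indicator (annulus R (b / R)) x)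
      \<le> ennreal (cmod (?H x) powr p) * v x"
    using int
  proof eventually_elim
    case (elim x)
    show ?case
    proof (cases "x \<in> annulus R (b / R)")
      case True
      define e where "e = (enn2real (v x) * \<bar>x\<bar>) powr (- 1 / p)"
      have "ennreal (a * e) = ennreal a * ennreal e"
        using a by (simp add: ennreal_mult e_def)
      also have "\<dots> \<le> (\<integral>\<^sup>+ t. g t * indicator (annulus (1 / R) R) t \<partial>lebesgue) * ennreal e"
        using a(2) by (intro mult_right_mono) auto
      also have "\<dots> \<le> ennreal (cmod (?H x))"
        unfolding e_def
        by (rule dunkl_hausdorff_extremal_ge[OF assms(1,2,3) g]) (use elim True in auto)
      finally have "a * e \<le> cmod (?H x)"
        by (simp add: ennreal_le_iff)
      then have "(a * e) powr p \<le> cmod (?H x) powr p"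
        using a assms(1) by (intro powr_mono2) (auto simp: e_def)
      then have "ennreal ((a * e) powr p) * v x \<le> ennreal (cmod (?H x) powr p) * v x"
        by (intro mult_right_mono ennreal_leI) auto
      moreover have "0 < \<bar>x\<bar>"
        using True assms(3) by (auto simp: annulus_def)
      ultimately show ?thesis
        using ennreal_scaled_powr_mult_weight[of p "v x" "\<bar>x\<bar>" a] elim assms(1) a True
        by (simp add: e_def)
    qed simp
  qed
  then have "(\<integral>\<^sup>+ x. ennreal (a powr p) * (ennreal (1 / \<bar>x\<bar>) * indicator (annulus R (b / R)) x) \<partial>lebesgue)
      \<le> Lpv_integral p v ?H"
    unfolding Lpv_integral_def by (rule nn_integral_mono_AE)
  moreover have "(\<integral>\<^sup>+ x. ennreal (a powr p) * (ennreal (1 / \<bar>x\<bar>) * indicator (annulus R (b / R)) x) \<partial>lebesgue)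
      = ennreal (a powr p) * ennreal (2 * (ln (b / R) - ln R))"
    unfolding nn_integral_inverse_annulus[OF assms(3) b(2), symmetric] nn_integral_completion
    by (rule nn_integral_cmult) measurable
  moreover have "ln R \<le> ln (b / R)"
    using b assms(3) by (simp add: ln_mono)
  moreover have "ln (b / R) - ln R = ln b - 2 * ln R"
    using b assms(3) by (simp add: ln_div)
  ultimately show ?thesis
    by (simp add: ennreal_mult)
qed


section \<open>Comparison with the operator norm\<close>

lemma Lpv_norm_le_Lpv_onorm:
  assumes "dunkl_hausdorff_bounded \<alpha> \<phi> p v" "f \<in> Lpv p v" "Lpv_norm p v f \<noteq> 0"
  shows "Lpv_norm p v (dunkl_hausdorff \<alpha> \<phi> f) \<le> Lpv_onorm p v (dunkl_hausdorff \<alpha> \<phi>) * Lpv_norm p v f"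
    and "0 \<le> Lpv_onorm p v (dunkl_hausdorff \<alpha> \<phi>)"
proof -
  let ?q = "\<lambda>f. Lpv_norm p v (dunkl_hausdorff \<alpha> \<phi> f) / Lpv_norm p v f"
  have nonneg: "0 \<le> Lpv_norm p v h" for h
    by (simp add: Lpv_norm_def)
  obtain C where C: "\<And>h. h \<in> Lpv p v \<Longrightarrow>
      Lpv_norm p v (dunkl_hausdorff \<alpha> \<phi> h) \<le> C * Lpv_norm p v h"
    using assms(1) unfolding dunkl_hausdorff_bounded_def by blast
  have "?q h \<le> max C 0" if "h \<in> Lpv p v" for h
  proof (cases "Lpv_norm p v h = 0")
    case False
    then have "0 < Lpv_norm p v h" using nonneg[of h] by linarith
    then have "?q h \<le> C"
      using C[OF that] by (simp add: divide_le_eq)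
    then show ?thesis by simp
  qed simp
  then have "bdd_above (?q ` Lpv p v)"
    by (intro bdd_aboveI2)
  then have q: "?q f \<le> Lpv_onorm p v (dunkl_hausdorff \<alpha> \<phi>)"
    unfolding Lpv_onorm_def by (intro cSUP_upper assms(2))
  have "0 < Lpv_norm p v f"
    using assms(3) nonneg[of f] by linarith
  then show "Lpv_norm p v (dunkl_hausdorff \<alpha> \<phi> f) \<le> Lpv_onorm p v (dunkl_hausdorff \<alpha> \<phi>) * Lpv_norm p v f"
    using q by (simp add: divide_le_eq)
  have "0 \<le> ?q f" by (simp add: nonneg)
  then show "0 \<le> Lpv_onorm p v (dunkl_hausdorff \<alpha> \<phi>)" using q by linarith
qed

lemma le_of_affine_le_linear:
  fixes A B :: real
  assumes "\<And>s. s > s0 \<Longrightarrow> A * (s - d) \<le> B * s"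
  shows "A \<le> B"
proof (rule ccontr)
  assume "\<not> A \<le> B"
  then have D: "0 < A - B" by simp
  define s where "s = max (s0 + 1) ((A * d + 1) / (A - B))"
  have "(A * d + 1) / (A - B) \<le> s" "s0 < s" by (auto simp: s_def)
  then have "A * d + 1 \<le> s * (A - B)" "A * (s - d) \<le> B * s"
    using D assms by (auto simp: pos_divide_le_eq)
  then show False by (simp add: algebra_simps)
qed

text \<open>With \<open>b = exp s\<close>, the definition of the operator norm \<open>M\<close> turns the lower bound into
  \<open>a powr p * (s - 2 * ln R) \<le> M powr p * s\<close>: the truncation loses only the constant \<open>2 * ln R\<close>,
  which becomes negligible as \<open>s\<close> grows.\<close>

lemma truncated_integral_le_Lpv_onorm:
  fixes g :: "real \<Rightarrow> ennreal"
  assumes "0 < p" "weight v" "1 < R"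
    and bdd: "dunkl_hausdorff_bounded \<alpha> \<phi> p v"
    and g: "g \<in> borel_measurable lebesgue"
      "\<And>t. g t \<le> ennreal (cmod (\<phi> t) / \<bar>t\<bar> powr (2 * \<alpha> + 2 - 1 / p) * inf_ratio v t powr (1 / p))"
  shows "(\<integral>\<^sup>+ t. g t * indicator (annulus (1 / R) R) t \<partial>lebesgue)
         \<le> ennreal (Lpv_onorm p v (dunkl_hausdorff \<alpha> \<phi>))"
proof (rule dense_le)
  fix a' assume a': "a' < (\<integral>\<^sup>+ t. g t * indicator (annulus (1 / R) R) t \<partial>lebesgue)"
  define M where "M = Lpv_onorm p v (dunkl_hausdorff \<alpha> \<phi>)"
  obtain a where a: "a' = ennreal a" "0 \<le> a"
    using a' by (cases a') auto
  have lnR: "0 < ln R" using assms(3) by simp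
  have main: "a powr p * (s - 2 * ln R) \<le> M powr p * s \<and> 0 \<le> M" if s: "s > 2 * ln R" for s
  proof -
    let ?f = "extremal p v (exp s)"
    let ?I = "Lpv_integral p v (dunkl_hausdorff \<alpha> \<phi> ?f)"
    have s0: "0 < s" using s lnR by linarith
    have If: "Lpv_integral p v ?f = ennreal (2 * s)"
      using Lpv_integral_extremal[of p v "exp s"] assms(1,2) s0 by simp
    have f: "?f \<in> Lpv p v"
      using extremal_measurable assms(2) If by (simp add: Lpv_def weight_def)
    have nf: "Lpv_norm p v ?f = (2 * s) powr (1 / p)"
      using s0 by (simp add: Lpv_norm_def If)
    then have nf0: "Lpv_norm p v ?f \<noteq> 0" using s0 by simp
    note M = Lpv_norm_le_Lpv_onorm[OF bdd f nf0, folded M_def]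
    have int: "AE x in lebesgue. integrable lebesgue (dunkl_hausdorff_integrand \<alpha> \<phi> ?f x)"
      and Hf: "dunkl_hausdorff \<alpha> \<phi> ?f \<in> Lpv p v"
      using bdd f unfolding dunkl_hausdorff_bounded_def by blast+
    \<comment> \<open>The smaller annulus \<open>R \<le> \<bar>x\<bar> \<le> b / R\<close> is nonempty.\<close>
    have "exp (2 * ln R) \<le> exp s" using s by simp
    then have R2: "R\<^sup>2 \<le> exp s"
      using assms(3) by (simp add: exp_double)
    have "ennreal (a powr p * (2 * (s - 2 * ln R))) \<le> ?I"
      using Lpv_integral_dunkl_hausdorff_extremal_ge[OF assms(1,2) _ R2 g int a(2)] a(1) a' assms(3)
      by (simp add: less_imp_le)
    moreover have "?I < \<infinity>" using Hf by (simp add: Lpv_def)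
    ultimately have "a powr p * (2 * (s - 2 * ln R)) \<le> enn2real ?I"
      by (cases ?I) (auto simp: ennreal_le_iff)
    also have "\<dots> = (Lpv_norm p v (dunkl_hausdorff \<alpha> \<phi> ?f)) powr p"
      using assms(1) by (simp add: Lpv_norm_def powr_powr)
    also have "\<dots> \<le> (M * (2 * s) powr (1 / p)) powr p"
      using M(1) assms(1) unfolding nf by (intro powr_mono2) (auto simp: Lpv_norm_def)
    also have "\<dots> = M powr p * (2 * s)"
      using assms(1) M(2) s0 by (simp add: powr_mult powr_powr)
    finally have "2 * (a powr p * (s - 2 * ln R)) \<le> 2 * (M powr p * s)"
      by (simp add: algebra_simps)
    then show ?thesis using M(2) by simp
  qed
  have "a powr p \<le> M powr p"
    using le_of_affine_le_linear main by blast
  moreover have "0 \<le> M"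
    using main[of "2 * ln R + 1"] by simp
  ultimately have "a \<le> M"
    using powr_less_mono2[of p M a] assms(1) by (cases "M < a") auto
  then show "a' \<le> ennreal (Lpv_onorm p v (dunkl_hausdorff \<alpha> \<phi>))"
    unfolding a(1) M_def by (rule ennreal_leI)
qed

text \<open>The annuli \<open>1 / R \<le> \<bar>t\<bar> \<le> R\<close> exhaust the line without the origin.\<close>

lemma measurable_minorant_integral_le_Lpv_onorm:
  fixes g :: "real \<Rightarrow> ennreal"
  assumes "0 < p" "weight v"
    and bdd: "dunkl_hausdorff_bounded \<alpha> \<phi> p v"
    and g: "g \<in> borel_measurable lebesgue"
      "\<And>t. g t \<le> ennreal (cmod (\<phi> t) / \<bar>t\<bar> powr (2 * \<alpha> + 2 - 1 / p) * inf_ratio v t powr (1 / p))"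
  shows "(\<integral>\<^sup>+ t. g t \<partial>lebesgue) \<le> ennreal (Lpv_onorm p v (dunkl_hausdorff \<alpha> \<phi>))"
proof -
  define K where "K n = annulus (1 / (real n + 2)) (real n + 2)" for n
  have K_sets [measurable]: "K n \<in> sets lebesgue" for n
    by (auto simp: K_def)
  have "incseq K"
    by (rule incseq_SucI) (force simp: K_def annulus_def field_simps intro: order_trans)
  then have inc: "incseq (\<lambda>n t. g t * indicator (K n) t)"
    by (auto simp: incseq_def le_fun_def intro!: mult_left_mono indicator_leI)
  have "(SUP n. g t * indicator (K n) t) = g t" for t
  proof (cases "t = 0")
    case True
    \<comment> \<open>The annuli omit the origin, where the bound on \<open>g\<close> is 0 because division by 0 gives 0.\<close>
    then show ?thesis using g(2)[of 0] by simp
  next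
    case False
    obtain n where n: "max \<bar>t\<bar> (1 / \<bar>t\<bar>) \<le> real n"
      using real_arch_simple by blast
    have "1 / \<bar>t\<bar> \<le> real n + 2" "\<bar>t\<bar> \<le> real n + 2"
      using n by auto
    then have "t \<in> K n"
      using False by (auto simp: K_def annulus_def field_simps)
    then have "g t * indicator (K n) t = g t" by simp
    then have "g t \<le> (SUP n. g t * indicator (K n) t)"
      by (metis SUP_upper UNIV_I)
    moreover have "(SUP n. g t * indicator (K n) t) \<le> g t"
      by (auto intro!: SUP_least simp: indicator_def)
    ultimately show ?thesis by simp
  qed
  then have "(\<integral>\<^sup>+ t. g t \<partial>lebesgue) = (\<integral>\<^sup>+ t. (SUP n. g t * indicator (K n) t) \<partial>lebesgue)"
    by simp
  also have "\<dots> = (SUP n. \<integral>\<^sup>+ t. g t * indicator (K n) t \<partial>lebesgue)"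
    using inc g(1) by (intro nn_integral_monotone_convergence_SUP) auto
  also have "\<dots> \<le> ennreal (Lpv_onorm p v (dunkl_hausdorff \<alpha> \<phi>))"
    unfolding K_def by (intro SUP_least truncated_integral_le_Lpv_onorm assms) auto
  finally show ?thesis .
qed

theorem theorem2p2:
  fixes p \<alpha> :: real and v :: "real \<Rightarrow> ennreal" and \<phi> :: "real \<Rightarrow> complex"
  assumes "1 < p"
    and "weight v"
    and "integrable lebesgue \<phi>"
    and "dunkl_hausdorff_bounded \<alpha> \<phi> p v"
  shows "ennreal (Lpv_onorm p v (dunkl_hausdorff \<alpha> \<phi>)) \<ge> A_inf \<alpha> \<phi> p v"
  \<comment> \<open>By definition of the integral, \<open>A_inf\<close> is the supremum of the integrals
    of the simple functions below its integrand.\<close>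
  unfolding A_inf_def nn_integral_def
proof (rule SUP_least)
  fix g :: "real \<Rightarrow> ennreal"
  assume g: "g \<in> {g. simple_function lebesgue g \<and>
      g \<le> (\<lambda>t. ennreal (cmod (\<phi> t) / \<bar>t\<bar> powr (2 * \<alpha> + 2 - 1 / p) * inf_ratio v t powr (1 / p)))}"
  then have "simple_function lebesgue g" by simp
  then have "integral\<^sup>S lebesgue g = (\<integral>\<^sup>+ t. g t \<partial>lebesgue)"
    by (simp add: nn_integral_eq_simple_integral)
  also have "\<dots> \<le> ennreal (Lpv_onorm p v (dunkl_hausdorff \<alpha> \<phi>))"
    by (rule measurable_minorant_integral_le_Lpv_onorm)
       (use g assms in \<open>auto simp: le_fun_def intro: borel_measurable_simple_function\<close>)
  finally show "integral\<^sup>S lebesgue g \<le> ennreal (Lpv_onorm p v (dunkl_hausdorff \<alpha> \<phi>))" .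
qed

end
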